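(* Let $S$ be a weak Gaussian semiring and $B$ a McCoy and weak content $S$-semialgebra such that the corresponding homomorphism $\lambda:S\to B$ is injective and the content function $c:B\to\mathrm{Fid}(S)$ is homogeneous and onto. Then $B$ has few zero-divisors if and only if $S$ has few zero-divisors and Property (A).
   Context: A semiring is a set $S$ with operations $+,\cdot$ such that $(S,+)$ is a commutative monoid with identity $0$, $(S,\cdot)$ is a commutative monoid with identity $1\neq 0$, multiplication distributes over addition, and $s\cdot 0=0$ for all $s\in S$. An ideal of $S$ is a nonempty subset closed under addition and under multiplication by elements of $S$; a proper ideal $\mathbf p$ is prime if $ab\in\mathbf p$ implies $a\in\mathbf p$ or $b\in\mathbf p$. $\mathrm{Fid}(S)$ is the set of finitely generated ideals of $S$. $\sqrt I=\{s\in S:s^n\in I\text{ for some }n\ge1\}$. $S$ is weak Gaussian if $A_fA_g\subseteq\sqrt{A_{fg}}$ for all $f,g\in S[X]$, where $A_f$ is the ideal generated by the coefficients of $f$; equivalently (known), every prime ideal $\mathbf p$ of $S$ is subtractive, i.e. $a+b,a\in\mathbf p$ imply $b\in\mathbf p$. An $S$-semialgebra is a semiring $B$ with a semiring morphism $\lambda:S\to B$ (preserving $+,\cdot,0,1$); write $s\cdot f=\lambda(s)f$, and for an ideal $I$ of $S$ let $IB$ be the ideal of $B$ generated by $\lambda(I)$. For $f\in B$, the content $c(f)$ is the intersection of all ideals $I$ of $S$ with $f\in IB$. $B$ is an Ohm-Rush $S$-semialgebra if $f\in c(f)B$ for all $f\in B$ (then every $c(f)$ is finitely generated). An Ohm-Rush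 $S$-semialgebra $B$ is: a McCoy $S$-semialgebra if $g\cdot f=0$ with $g,f\in B$, $g\neq0$, implies $s\cdot c(f)=0$ for some nonzero $s\in S$; a weak content $S$-semialgebra if $c(f)c(g)\subseteq\sqrt{c(fg)}$ for all $f,g\in B$. The content function is homogeneous if $c(s\cdot f)=s\cdot c(f)$ for all $s\in S$, $f\in B$. For a semiring $S$, $Z(S)$ is the set of $s\in S$ with $st=0$ for some nonzero $t\in S$. $S$ has few zero-divisors if $Z(S)$ is a finite union of prime ideals of $S$ (similarly for $B$). $S$ has Property (A) if every finitely generated ideal $I\subseteq Z(S)$ satisfies $s\cdot I=0$ for some nonzero $s\in S$. *)

theory Defs
  imports Complex_Main "HOL-Computational_Algebra.Polynomial"
begin

text \<open>
  The class \<^class>\<open>comm_semiring_1\<close> has exactly the semiring axioms intended here: both operations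
  are commutative monoids, \<open>0\<close> is absorbing, and \<open>0 \<noteq> 1\<close>; no cancellation or subtraction is assumed.
\<close>

definition is_ideal :: "'a::comm_semiring_1 set \<Rightarrow> bool" where
  "is_ideal I \<longleftrightarrow> I \<noteq> {} \<and> (\<forall>a\<in>I. \<forall>b\<in>I. a + b \<in> I) \<and> (\<forall>s. \<forall>a\<in>I. s * a \<in> I)"

definition prime_ideal :: "'a::comm_semiring_1 set \<Rightarrow> bool" where
  "prime_ideal p \<longleftrightarrow>
     is_ideal p \<and> p \<noteq> UNIV \<and> (\<forall>a b. a * b \<in> p \<longrightarrow> a \<in> p \<or> b \<in> p)"

definition ideal_gen :: "'a::comm_semiring_1 set \<Rightarrow> 'a set" where
  "ideal_gen X = is_ideal hull X"

definition Fid :: "'a::comm_semiring_1 set set" where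
  "Fid = {I. \<exists>X. finite X \<and> I = ideal_gen X}"

definition ideal_prod :: "'a::comm_semiring_1 set \<Rightarrow> 'a set \<Rightarrow> 'a set" where
  "ideal_prod I J = ideal_gen {a * b | a b. a \<in> I \<and> b \<in> J}"

definition ideal_scale :: "'a::comm_semiring_1 \<Rightarrow> 'a set \<Rightarrow> 'a set" where
  "ideal_scale s I = (\<lambda>x. s * x) ` I"

definition radical :: "'a::comm_semiring_1 set \<Rightarrow> 'a set" where
  "radical I = {s. \<exists>n\<ge>1. s ^ n \<in> I}"

definition poly_content :: "'a::comm_semiring_1 poly \<Rightarrow> 'a set" where
  "poly_content f = ideal_gen (range (coeff f))"

text \<open>\<open>TYPE('a)\<close> arguments let properties of the whole semiring \<open>'a\<close> be stated as predicates.\<close>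

definition weak_gaussian :: "'a::comm_semiring_1 itself \<Rightarrow> bool" where
  "weak_gaussian _ \<longleftrightarrow>
     (\<forall>f g :: 'a poly.
        ideal_prod (poly_content f) (poly_content g) \<subseteq> radical (poly_content (f * g)))"

definition zero_divisors :: "'a::comm_semiring_1 set" where
  "zero_divisors = {s. \<exists>t. t \<noteq> 0 \<and> s * t = 0}"

definition few_zero_divisors :: "'a::comm_semiring_1 itself \<Rightarrow> bool" where
  "few_zero_divisors _ \<longleftrightarrow>
     (\<exists>P :: 'a set set. finite P \<and> (\<forall>p\<in>P. prime_ideal p) \<and> zero_divisors = \<Union>P)"

definition property_A :: "'a::comm_semiring_1 itself \<Rightarrow> bool" where
  "property_A _ \<longleftrightarrow>
     (\<forall>I\<in>Fid. I \<subseteq> (zero_divisors :: 'a set) \<longrightarrow> (\<exists>s. s \<noteq> 0 \<and> ideal_scale s I = {0}))"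

text \<open>An \<open>S\<close>-semialgebra \<open>B\<close> is given by its structure morphism \<open>h : S \<rightarrow> B\<close>.\<close>

definition semialgebra :: "('s::comm_semiring_1 \<Rightarrow> 'b::comm_semiring_1) \<Rightarrow> bool" where
  "semialgebra h \<longleftrightarrow>
     h 0 = 0 \<and> h 1 = 1 \<and> (\<forall>x y. h (x + y) = h x + h y) \<and> (\<forall>x y. h (x * y) = h x * h y)"

definition act :: "('s::comm_semiring_1 \<Rightarrow> 'b::comm_semiring_1) \<Rightarrow> 's \<Rightarrow> 'b \<Rightarrow> 'b" where
  "act h s f = h s * f"

definition ideal_ext :: "('s::comm_semiring_1 \<Rightarrow> 'b::comm_semiring_1) \<Rightarrow> 's set \<Rightarrow> 'b set" where
  "ideal_ext h I = ideal_gen (h ` I)"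

definition content_ideal :: "('s::comm_semiring_1 \<Rightarrow> 'b::comm_semiring_1) \<Rightarrow> 'b \<Rightarrow> 's set" where
  "content_ideal h f = \<Inter>{I. is_ideal I \<and> f \<in> ideal_ext h I}"

definition ohm_rush :: "('s::comm_semiring_1 \<Rightarrow> 'b::comm_semiring_1) \<Rightarrow> bool" where
  "ohm_rush h \<longleftrightarrow> semialgebra h \<and> (\<forall>f. f \<in> ideal_ext h (content_ideal h f))"

definition mccoy :: "('s::comm_semiring_1 \<Rightarrow> 'b::comm_semiring_1) \<Rightarrow> bool" where
  "mccoy h \<longleftrightarrow> ohm_rush h \<and>
     (\<forall>g f. g * f = 0 \<and> g \<noteq> 0 \<longrightarrow> (\<exists>s. s \<noteq> 0 \<and> ideal_scale s (content_ideal h f) = {0}))"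

definition weak_content :: "('s::comm_semiring_1 \<Rightarrow> 'b::comm_semiring_1) \<Rightarrow> bool" where
  "weak_content h \<longleftrightarrow> ohm_rush h \<and>
     (\<forall>f g. ideal_prod (content_ideal h f) (content_ideal h g) \<subseteq> radical (content_ideal h (f * g)))"

definition homogeneous_content :: "('s::comm_semiring_1 \<Rightarrow> 'b::comm_semiring_1) \<Rightarrow> bool" where
  "homogeneous_content h \<longleftrightarrow> (\<forall>s f. content_ideal h (act h s f) = ideal_scale s (content_ideal h f))"

end

(*
  An element f of B is a zero divisor iff its content is annihilated by a nonzero scalar: one
  direction is the McCoy property, the other follows from homogeneity and injectivity. In a weak
  Gaussian semiring every prime ideal is subtractive, so that prime avoidance is available. A
  zero divisor f of B then has its content in one of the primes p covering Z(S), i.e. f lies in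
  the extension pB, and pB is prime by the weak content property. Conversely, primes covering Z(B)
  contract to primes covering Z(S), and a finitely generated ideal c(f) inside Z(S) lies in the
  contraction of a single prime, which makes f a zero divisor; McCoy then annihilates c(f).
*)

theory Submission
  imports Defs
begin

section \<open>Ideals and prime avoidance\<close>

lemma ideal_add: "is_ideal I \<Longrightarrow> a \<in> I \<Longrightarrow> b \<in> I \<Longrightarrow> a + b \<in> I"
  by (auto simp: is_ideal_def)

lemma ideal_mult_left: "is_ideal I \<Longrightarrow> a \<in> I \<Longrightarrow> s * a \<in> I"
  by (auto simp: is_ideal_def)

lemma ideal_mult_right: "is_ideal I \<Longrightarrow> a \<in> I \<Longrightarrow> a * s \<in> I"
  by (metis ideal_mult_left mult.commute)

lemma ideal_zero: "is_ideal I \<Longrightarrow> 0 \<in> I"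
  unfolding is_ideal_def by (metis equals0I mult_zero_left)

lemma is_ideal_Inter:
  assumes "\<And>I. I \<in> A \<Longrightarrow> is_ideal I"
  shows "is_ideal (\<Inter>A)"
proof -
  have "0 \<in> \<Inter>A"
    using assms ideal_zero by blast
  then show ?thesis
    using assms unfolding is_ideal_def by blast
qed

lemma is_ideal_ideal_gen: "is_ideal (ideal_gen X)"
  unfolding ideal_gen_def by (rule hull_in) (auto intro: is_ideal_Inter)

lemma subset_ideal_gen: "X \<subseteq> ideal_gen X"
  unfolding ideal_gen_def by (rule hull_subset)

lemma ideal_gen_minimal: "X \<subseteq> I \<Longrightarrow> is_ideal I \<Longrightarrow> ideal_gen X \<subseteq> I"
  unfolding ideal_gen_def by (rule hull_minimal)

lemma is_ideal_zero: "is_ideal {0}"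
  by (simp add: is_ideal_def)

lemma prime_ideal_imp_ideal: "prime_ideal p \<Longrightarrow> is_ideal p"
  by (simp add: prime_ideal_def)

lemma prime_ideal_mult: "prime_ideal p \<Longrightarrow> a * b \<in> p \<Longrightarrow> a \<in> p \<or> b \<in> p"
  by (auto simp: prime_ideal_def)

lemma prime_ideal_one_notin:
  assumes "prime_ideal p"
  shows "1 \<notin> p"
proof
  assume "1 \<in> p"
  then have "s \<in> p" for s
    using ideal_mult_left[OF prime_ideal_imp_ideal[OF assms], of 1 s] by simp
  then show False
    using assms by (auto simp: prime_ideal_def)
qed

text \<open>The exponent 0 is harmless: the power is then \<open>1\<close>, which lies outside
  \<open>p\<close>.\<close>

lemma prime_ideal_power: "prime_ideal p \<Longrightarrow> a ^ n \<in> p \<Longrightarrow> a \<in> p"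
  by (induction n) (auto simp: prime_ideal_one_notin dest: prime_ideal_mult)

lemma radical_subset_prime: "prime_ideal p \<Longrightarrow> I \<subseteq> p \<Longrightarrow> radical I \<subseteq> p"
  unfolding radical_def using prime_ideal_power by blast

lemma prime_ideal_prod:
  assumes "prime_ideal p" "finite A" "prod x A \<in> p"
  shows "\<exists>i\<in>A. x i \<in> p"
  using assms(2,3)
proof (induction A)
  case empty
  then show ?case
    using prime_ideal_one_notin[OF assms(1)] by simp
next
  case (insert a A)
  then show ?case
    using prime_ideal_mult[OF assms(1), of "x a" "prod x A"] by auto
qed

lemma ideal_prod_mem:
  assumes "is_ideal I" "finite A" "i \<in> A" "x i \<in> I"
  shows "prod x A \<in> I"
  using assms by (simp add: prod.remove ideal_mult_right)

lemma mult_mem_ideal_prod: "a \<in> I \<Longrightarrow> b \<in> J \<Longrightarrow> a * b \<in> ideal_prod I J"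
  unfolding ideal_prod_def by (rule subsetD[OF subset_ideal_gen]) blast

text \<open>This stands in for the subtraction that lets one cancel a known summand inside an ideal
  of a ring; ideals of a semiring need not allow it.\<close>

definition subtractive :: "'a::comm_semiring_1 set \<Rightarrow> bool" where
  "subtractive I \<longleftrightarrow> (\<forall>a b. a \<in> I \<longrightarrow> a + b \<in> I \<longrightarrow> b \<in> I)"

lemma subtractiveD: "subtractive I \<Longrightarrow> a \<in> I \<Longrightarrow> a + b \<in> I \<Longrightarrow> b \<in> I"
  unfolding subtractive_def by blast

lemma weak_gaussian_imp_subtractive:
  fixes p :: "'a::comm_semiring_1 set"
  assumes wg: "weak_gaussian TYPE('a)" and p: "prime_ideal p"
  shows "subtractive p"
  unfolding subtractive_def
proof (intro allI impI)
  fix a b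
  assume a: "a \<in> p" and ab: "a + b \<in> p"
  txt \<open>The product of \<open>a + b X + a X\<^sup>2\<close> and \<open>1 + X\<close> has only the coefficients \<open>a\<close> and \<open>a + b\<close>.\<close>
  let ?f = "[:a, b, a:]" and ?g = "[:1, 1:]"
  have fg: "?f * ?g = [:a, a + b, a + b, a:]"
    by (simp add: algebra_simps)
  have "range (coeff (?f * ?g)) \<subseteq> p"
    unfolding fg
    using a ab ideal_zero[OF prime_ideal_imp_ideal[OF p]]
    by (auto simp: coeff_pCons split: nat.splits)
  then have "radical (poly_content (?f * ?g)) \<subseteq> p"
    unfolding poly_content_def
    by (intro radical_subset_prime ideal_gen_minimal p prime_ideal_imp_ideal)
  \<comment> \<open>\<open>b\<close> is the linear coefficient of \<open>?f\<close> and
    \<open>1\<close> the constant one of \<open>?g\<close>, so the weak Gaussian inclusion puts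
    \<open>b * 1\<close> into the radical just bounded by \<open>p\<close>.\<close>
  moreover have "b \<in> poly_content ?f" "1 \<in> poly_content ?g"
    unfolding poly_content_def
    using subset_ideal_gen[of "range (coeff ?f)"] subset_ideal_gen[of "range (coeff ?g)"]
      rangeI[of "coeff ?f" 1] rangeI[of "coeff ?g" 0] by auto
  then have "b * 1 \<in> ideal_prod (poly_content ?f) (poly_content ?g)"
    by (rule mult_mem_ideal_prod)
  moreover have "ideal_prod (poly_content ?f) (poly_content ?g) \<subseteq> radical (poly_content (?f * ?g))"
    using wg unfolding weak_gaussian_def by blast
  ultimately have "b * 1 \<in> p"
    by blast
  then show "b \<in> p"
    by simp
qed

text \<open>The ring-theoretic argument carries over once subtractivity replaces subtraction:
  redundant members are dropped by induction, and an irredundant cover with two or more members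
  yields an element of \<open>I\<close> outside all of them.\<close>

lemma prime_avoidance:
  fixes I :: "'a::comm_semiring_1 set"
  assumes "finite P" and "\<And>p. p \<in> P \<Longrightarrow> prime_ideal p" and "\<And>p. p \<in> P \<Longrightarrow> subtractive p"
    and I: "is_ideal I" and "I \<subseteq> \<Union>P"
  shows "\<exists>p\<in>P. I \<subseteq> p"
  using assms(1-3,5)
proof (induction P rule: finite_psubset_induct)
  case (psubset P)
  show ?case
  proof (cases "\<exists>q\<in>P. I \<subseteq> \<Union>(P - {q})")
    case True
    then obtain q where q: "q \<in> P" "I \<subseteq> \<Union>(P - {q})"
      by blast
    then have "\<exists>p\<in>P - {q}. I \<subseteq> p"
      by (intro psubset.IH) (use psubset.prems in auto)
    then show ?thesis
      by blast
  next
    case False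
    then have "\<forall>q\<in>P. \<exists>x. x \<in> I \<and> x \<notin> \<Union>(P - {q})"
      by blast
    then obtain x where x: "\<And>q. q \<in> P \<Longrightarrow> x q \<in> I" "\<And>q. q \<in> P \<Longrightarrow> x q \<notin> \<Union>(P - {q})"
      by metis
    have xq: "x q \<in> q" if "q \<in> P" for q
      using x[OF that] psubset.prems(3) that by blast
    obtain p where p: "p \<in> P"
      using ideal_zero[OF I] psubset.prems(3) by blast
    show ?thesis
    \<comment> \<open>The singleton is split off because the product below would then be empty,
      hence \<open>1\<close>, with no reason to lie in \<open>I\<close>.\<close>
    proof (cases "P = {p}")
      case True
      then show ?thesis
        using psubset.prems(3) by simp
    next
      case False
      \<comment> \<open>Each \<open>x q\<close> lies in \<open>q\<close> and in no other member. So
        \<open>?y\<close> lies in every member except \<open>p\<close>, which is prime, while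
        \<open>x p\<close> lies in \<open>p\<close> alone; by subtractivity \<open>x p + ?y\<close>
        is in no member.\<close>
      let ?y = "prod x (P - {p})"
      have fin: "finite (P - {p})"
        using psubset.hyps by simp
      obtain r where "r \<in> P - {p}"
        using False p by blast
      then have "?y \<in> I"
        using ideal_prod_mem[OF I fin] x(1) by blast
      then have "x p + ?y \<in> I"
        using ideal_add[OF I] x(1)[OF p] by blast
      then obtain q where q: "q \<in> P" "x p + ?y \<in> q"
        using psubset.prems(3) by blast
      have False
      proof (cases "q = p")
        case True
        then have "?y \<in> p"
          using q xq[OF p] psubset.prems(2)[OF p] by (blast intro: subtractiveD)
        then show False
          using prime_ideal_prod[OF psubset.prems(1)[OF p] fin] x(2) p by blast
      next
        case False
        then have "?y \<in> q"
          using q xq fin prime_ideal_imp_ideal[OF psubset.prems(1)]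
          by (intro ideal_prod_mem[of q _ q]) auto
        then have "x p \<in> q"
          using q(2) psubset.prems(2)[OF q(1)] by (metis add.commute subtractiveD)
        then show False
          using x(2)[OF p] q(1) False by blast
      qed
      then show ?thesis ..
    qed
  qed
qed

section \<open>Contents and zero divisors\<close>

lemma one_notin_zero_divisors: "1 \<notin> zero_divisors"
  by (simp add: zero_divisors_def)

lemma ideal_scale_zero_subset: "s \<noteq> 0 \<Longrightarrow> ideal_scale s I = {0} \<Longrightarrow> I \<subseteq> zero_divisors"
  unfolding zero_divisors_def ideal_scale_def by (auto simp: mult.commute)

lemma is_ideal_ideal_ext: "is_ideal (ideal_ext h I)"
  unfolding ideal_ext_def by (rule is_ideal_ideal_gen)

lemma is_ideal_content: "is_ideal (content_ideal h f)"
  unfolding content_ideal_def by (rule is_ideal_Inter) auto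

lemma ideal_ext_mono: "I \<subseteq> J \<Longrightarrow> ideal_ext h I \<subseteq> ideal_ext h J"
  unfolding ideal_ext_def ideal_gen_def by (intro hull_mono image_mono)

lemma ideal_ext_zero: "semialgebra h \<Longrightarrow> ideal_ext h {0} = {0}"
  unfolding ideal_ext_def semialgebra_def
  using ideal_gen_minimal[of "{0}" "{0}"] subset_ideal_gen[of "{0}"] is_ideal_zero by auto

text \<open>The Ohm-Rush condition makes the content itself one of the ideals being intersected,
  hence the least of them. This trades membership in an extended ideal for a containment in the base
  semiring.\<close>

lemma content_subset_iff:
  assumes "ohm_rush h" "is_ideal I"
  shows "content_ideal h f \<subseteq> I \<longleftrightarrow> f \<in> ideal_ext h I"
proof
  assume "content_ideal h f \<subseteq> I"
  then show "f \<in> ideal_ext h I"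
    using assms(1) ideal_ext_mono unfolding ohm_rush_def by blast
next
  assume "f \<in> ideal_ext h I"
  then show "content_ideal h f \<subseteq> I"
    using assms(2) unfolding content_ideal_def by blast
qed

lemma content_eq_zero_iff:
  assumes "ohm_rush h"
  shows "content_ideal h f = {0} \<longleftrightarrow> f = 0"
  using content_subset_iff[OF assms is_ideal_zero, of f] ideal_ext_zero[of h]
    ideal_zero[OF is_ideal_content[of h f]] assms
  by (auto simp: ohm_rush_def)

lemma ideal_ext_subset_vimage:
  "is_ideal Q \<Longrightarrow> I \<subseteq> h -` Q \<Longrightarrow> ideal_ext h I \<subseteq> Q"
  unfolding ideal_ext_def by (intro ideal_gen_minimal) auto

lemma prime_ideal_vimage:
  assumes "semialgebra h" "prime_ideal Q"
  shows "prime_ideal (h -` Q)"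
proof -
  have "h 1 \<notin> Q" "h 0 \<in> Q"
    using assms prime_ideal_one_notin ideal_zero[OF prime_ideal_imp_ideal]
    by (auto simp: semialgebra_def)
  then have "h -` Q \<noteq> {}" "h -` Q \<noteq> UNIV"
    by auto
  then show ?thesis
    using assms unfolding prime_ideal_def is_ideal_def semialgebra_def by simp
qed

text \<open>The weak content inclusion puts every product of an element of one content with an
  element of the other into \<open>p\<close>. Two elements outside \<open>p\<close>, one from each
  content, would contradict primality, so one content lies wholly in \<open>p\<close>.\<close>

lemma weak_content_prime_ideal_ext:
  assumes wc: "weak_content h" and p: "prime_ideal p" and proper: "ideal_ext h p \<noteq> UNIV"
  shows "prime_ideal (ideal_ext h p)"
  unfolding prime_ideal_def
proof (intro conjI is_ideal_ideal_ext proper allI impI)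
  fix f g
  assume fg: "f * g \<in> ideal_ext h p"
  have oh: "ohm_rush h"
    using wc by (simp add: weak_content_def)
  note iff = content_subset_iff[OF oh prime_ideal_imp_ideal[OF p]]
  have "radical (content_ideal h (f * g)) \<subseteq> p"
    using fg by (intro radical_subset_prime p) (simp add: iff)
  then have "ideal_prod (content_ideal h f) (content_ideal h g) \<subseteq> p"
    using wc unfolding weak_content_def by blast
  then have "a \<in> p \<or> b \<in> p" if "a \<in> content_ideal h f" "b \<in> content_ideal h g" for a b
    using prime_ideal_mult[OF p] mult_mem_ideal_prod[OF that] by blast
  then have "content_ideal h f \<subseteq> p \<or> content_ideal h g \<subseteq> p"
    by blast
  then show "f \<in> ideal_ext h p \<or> g \<in> ideal_ext h p"
    by (simp add: iff)
qed

lemma zero_divisors_iff_content: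
  assumes mc: "mccoy h" and inj: "inj h" and hom: "homogeneous_content h"
  shows "f \<in> zero_divisors \<longleftrightarrow> (\<exists>s. s \<noteq> 0 \<and> ideal_scale s (content_ideal h f) = {0})"
proof
  assume "f \<in> zero_divisors"
  then obtain g where "g \<noteq> 0" "g * f = 0"
    unfolding zero_divisors_def by (auto simp: mult.commute)
  then show "\<exists>s. s \<noteq> 0 \<and> ideal_scale s (content_ideal h f) = {0}"
    using mc unfolding mccoy_def by blast
next
  assume "\<exists>s. s \<noteq> 0 \<and> ideal_scale s (content_ideal h f) = {0}"
  then obtain s where s: "s \<noteq> 0" "ideal_scale s (content_ideal h f) = {0}"
    by blast
  have oh: "ohm_rush h"
    using mc by (simp add: mccoy_def)
  \<comment> \<open>Homogeneity turns an annihilated content into the vanishing of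
    \<open>h s * f\<close>; injectivity keeps \<open>h s\<close> nonzero.\<close>
  have "content_ideal h (act h s f) = {0}"
    using hom s(2) by (simp add: homogeneous_content_def)
  then have "f * h s = 0"
    using content_eq_zero_iff[OF oh] by (simp add: act_def mult.commute)
  moreover have "h s \<noteq> 0"
    using s(1) inj oh by (metis injD ohm_rush_def semialgebra_def)
  ultimately show "f \<in> zero_divisors"
    unfolding zero_divisors_def by blast
qed

text \<open>If \<open>h s\<close> kills \<open>g\<close>, then \<open>s\<close> kills the content of
  \<open>g\<close> by homogeneity, and that content has a nonzero element when \<open>g\<close> is
  nonzero. Injectivity carries annihilators the other way.\<close>

lemma vimage_zero_divisors:
  fixes h :: "'s::comm_semiring_1 \<Rightarrow> 'b::comm_semiring_1"
  assumes oh: "ohm_rush h" and inj: "inj h" and hom: "homogeneous_content h"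
  shows "h -` (zero_divisors :: 'b set) = (zero_divisors :: 's set)"
proof (intro set_eqI iffI)
  fix s :: 's
  assume "s \<in> h -` zero_divisors"
  then obtain g where g: "g \<noteq> 0" "h s * g = 0"
    by (auto simp: zero_divisors_def)
  have "ideal_scale s (content_ideal h g) = content_ideal h (act h s g)"
    using hom by (simp add: homogeneous_content_def)
  also have "\<dots> = {0}"
    using g(2) content_eq_zero_iff[OF oh] by (simp add: act_def)
  finally have scale: "ideal_scale s (content_ideal h g) = {0}" .
  obtain x where "x \<in> content_ideal h g" "x \<noteq> 0"
    using content_eq_zero_iff[OF oh, of g] g(1) ideal_zero[OF is_ideal_content[of h g]] by blast
  then show "s \<in> zero_divisors"
    using scale unfolding zero_divisors_def ideal_scale_def by blast
next
  fix s :: 's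
  assume "s \<in> zero_divisors"
  then obtain t where t: "t \<noteq> 0" "s * t = 0"
    by (auto simp: zero_divisors_def)
  have "h t \<noteq> 0" "h s * h t = 0"
    using t inj oh by (metis injD ohm_rush_def semialgebra_def)+
  then show "s \<in> h -` zero_divisors"
    by (auto simp: zero_divisors_def)
qed

theorem theorem4p10:
  fixes h :: "'s::comm_semiring_1 \<Rightarrow> 'b::comm_semiring_1"
  assumes "weak_gaussian TYPE('s)"
    and "mccoy h"
    and "weak_content h"
    and "inj h"
    and "homogeneous_content h"
    and "range (content_ideal h) = Fid"
  shows "few_zero_divisors TYPE('b) \<longleftrightarrow> few_zero_divisors TYPE('s) \<and> property_A TYPE('s)"
proof -
  have oh: "ohm_rush h" and sa: "semialgebra h"
    using assms(2) by (simp_all add: mccoy_def ohm_rush_def)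
  have subtr: "subtractive p" if "prime_ideal p" for p :: "'s set"
    using weak_gaussian_imp_subtractive assms(1) that .
  note zd_iff = zero_divisors_iff_content[OF assms(2,4,5)]
  show ?thesis
  proof
    assume "few_zero_divisors TYPE('b)"
    then obtain Q :: "'b set set" where Q: "finite Q" "\<And>q. q \<in> Q \<Longrightarrow> prime_ideal q"
      "zero_divisors = \<Union>Q"
      unfolding few_zero_divisors_def by blast
    let ?P = "(\<lambda>q. h -` q) ` Q"
    have P: "finite ?P" "\<And>p. p \<in> ?P \<Longrightarrow> prime_ideal p"
      using Q prime_ideal_vimage[OF sa] by auto
    have zd: "zero_divisors = \<Union>?P"
      using vimage_zero_divisors[OF oh assms(4,5)] unfolding Q(3) by blast
    have "property_A TYPE('s)"
      unfolding property_A_def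
    proof (intro ballI impI)
      fix I :: "'s set"
      assume "I \<in> Fid" "I \<subseteq> zero_divisors"
      \<comment> \<open>Surjectivity onto \<open>Fid\<close> encodes the whole ideal in one element
        \<open>f\<close>, so that a common annihilator can be sought by showing \<open>f\<close> to
        be a zero divisor.\<close>
      then obtain f where f: "I = content_ideal h f"
        using assms(6) by blast
      have "\<exists>p\<in>?P. I \<subseteq> p"
      proof (rule prime_avoidance[OF P subtr[OF P(2)]])
        show "is_ideal I"
          unfolding f by (rule is_ideal_content)
        show "I \<subseteq> \<Union>?P"
          using \<open>I \<subseteq> zero_divisors\<close> unfolding zd .
      qed
      then obtain q where q: "q \<in> Q" "I \<subseteq> h -` q"
        by blast
      have "f \<in> ideal_ext h I"
        using oh f by (simp add: ohm_rush_def)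
      also have "ideal_ext h I \<subseteq> q"
        using q Q(2) by (intro ideal_ext_subset_vimage prime_ideal_imp_ideal)
      finally have "f \<in> zero_divisors"
        using q(1) Q(3) by blast
      then show "\<exists>s. s \<noteq> 0 \<and> ideal_scale s I = {0}"
        unfolding f zd_iff .
    qed
    moreover have "few_zero_divisors TYPE('s)"
      unfolding few_zero_divisors_def using P zd by blast
    ultimately show "few_zero_divisors TYPE('s) \<and> property_A TYPE('s)"
      by blast
  next
    assume "few_zero_divisors TYPE('s) \<and> property_A TYPE('s)"
    then obtain P :: "'s set set" where P: "finite P" "\<And>p. p \<in> P \<Longrightarrow> prime_ideal p"
      "zero_divisors = \<Union>P" and pA: "property_A TYPE('s)"
      unfolding few_zero_divisors_def by blast
    have "f \<in> zero_divisors \<longleftrightarrow> (\<exists>p\<in>P. f \<in> ideal_ext h p)" for f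
    proof -
      \<comment> \<open>Property (A) speaks of finitely generated ideals only; the hypothesis on the
        range makes every content one.\<close>
      have "content_ideal h f \<in> Fid"
        using assms(6) by blast
      then have "content_ideal h f \<subseteq> zero_divisors \<Longrightarrow> f \<in> zero_divisors"
        using pA unfolding zd_iff property_A_def by simp
      moreover have "f \<in> zero_divisors \<Longrightarrow> content_ideal h f \<subseteq> zero_divisors"
        unfolding zd_iff by (elim exE conjE) (rule ideal_scale_zero_subset)
      ultimately have "f \<in> zero_divisors \<longleftrightarrow> content_ideal h f \<subseteq> zero_divisors"
        by (rule iffI[rotated])
      also have "\<dots> \<longleftrightarrow> (\<exists>p\<in>P. content_ideal h f \<subseteq> p)"
        using prime_avoidance[OF P(1,2) subtr[OF P(2)] is_ideal_content[of h f]]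
        unfolding P(3) by (auto simp del: Union_iff)
      also have "\<dots> \<longleftrightarrow> (\<exists>p\<in>P. f \<in> ideal_ext h p)"
        by (intro bex_cong refl content_subset_iff[OF oh] prime_ideal_imp_ideal P(2))
      finally show ?thesis .
    qed
    then have zd: "zero_divisors = \<Union>(ideal_ext h ` P)"
      by blast
    \<comment> \<open>Properness holds because each extension consists of zero divisors and
      therefore misses \<open>1\<close>.\<close>
    then have "prime_ideal (ideal_ext h p)" if "p \<in> P" for p
      using that P(2) one_notin_zero_divisors
      by (intro weak_content_prime_ideal_ext[OF assms(3)]) blast+
    then show "few_zero_divisors TYPE('b)"
      unfolding few_zero_divisors_def using zd P(1) by blast
  qed
qed

end
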